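(* Given two elements $\pi_c$ and $\nu_c$ of $\mathcal{Q}_+(\mathcal{X})$ with respective densities $d\pi_c$ and $d\nu_c$ with respect to some dominating measure $\lambda\in\mathcal{Q}_+(\mathcal{X})$ and a number $\xi\in(0,1/2)$, define $\pi_m$ and $\nu_m$ in $\mathcal{Q}_+(\mathcal{X})$ by their densities $d\pi_m$ and $d\nu_m$ with respect to $\lambda$ in the following way: $$\sqrt{d\pi_m}=\xi\sqrt{d\nu_c}+(1-\xi)\sqrt{d\pi_c}\quad\text{and}\quad\sqrt{d\nu_m}=\xi\sqrt{d\pi_c}+(1-\xi)\sqrt{d\nu_c}.$$ Then for all $x\in\mathbb{R}$, $\mu\in\mathcal{Q}_+(\mathcal{X})$ and $\boldsymbol{X}$ a Poisson process with mean measure $\mu$, $$\mathbb{P}_\mu\left[\log\left(\frac{dQ_{\pi_m}}{dQ_{\nu_m}}(\boldsymbol{X})\right)\ge2x\right]\le\exp\left[-x+(1-2\xi)\left(\frac2\xi H^2(\mu,\nu_c)-H^2(\pi_c,\nu_c)\right)\right]$$ and $$\mathbb{P}_\mu\left[\log\left(\frac{dQ_{\pi_m}}{dQ_{\nu_m}}(\boldsymbol{X})\right)\le2x\right]\le\exp\left[x+(1-2\xi)\left(\frac2\xi H^2(\mu,\pi_c)-H^2(\pi_c,\nu_c)\right)\right].$$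
   Context: $(\mathcal{X},\mathcal{E})$ is a measurable space and $\mathcal{Q}_+(\mathcal{X})$ the set of finite positive measures on it. A Poisson process with mean measure $\mu\in\mathcal{Q}_+(\mathcal{X})$ is a point process $\boldsymbol{X}=\{X_1,\dots,X_N\}$ such that $N$ is Poisson with parameter $\mu(\mathcal{X})$ and, conditionally on $N$, the $X_i$ are i.i.d. with distribution $\mu/\mu(\mathcal{X})$; $Q_\mu$ denotes its distribution and $\mathbb{P}_\mu$ probability when $\boldsymbol{X}$ has mean measure $\mu$. If $\mu\ll\nu$, then $Q_\mu\ll Q_\nu$ with $\frac{dQ_\mu}{dQ_\nu}(X_1,\dots,X_N)=\exp[\nu(\mathcal{X})-\mu(\mathcal{X})]\prod_{i=1}^N\frac{d\mu}{d\nu}(X_i)$ (an empty product equals 1). For $\mu,\mu'\in\mathcal{Q}_+(\mathcal{X})$, $H^2(\mu,\mu')=\frac12\int(\sqrt{d\mu/d\nu}-\sqrt{d\mu'/d\nu})^2d\nu$ for any measure $\nu$ dominating both. *)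

theory Defs
  imports "HOL-Probability.Probability"
begin

text \<open>
  A realisation \<open>{X\<^sub>1, ..., X\<^sub>N}\<close> of a finite point process on \<open>M\<close> is represented by the list
  \<open>[X\<^sub>1, ..., X\<^sub>N]\<close>. The space of lists is the disjoint union of the finite powers of \<open>M\<close>: a set of
  lists is measurable iff its trace on each power is.
\<close>

definition point_lists :: "'a measure \<Rightarrow> 'a list measure" where
  "point_lists M = sigma (lists (space M))
     {A. A \<subseteq> lists (space M) \<and>
         (\<forall>n. (\<lambda>x. map x [0..<n]) -` A \<inter> space (Pi\<^sub>M {..<n} (\<lambda>_. M)) \<in> sets (Pi\<^sub>M {..<n} (\<lambda>_. M)))}"

definition iid_points :: "nat \<Rightarrow> 'a measure \<Rightarrow> 'a list measure" where
  "iid_points n D = distr (Pi\<^sub>M {..<n} (\<lambda>_. D)) (point_lists D) (\<lambda>x. map x [0..<n])"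

text \<open>The constant \<open>poisson_pmf\<close> is only specified for positive rates; rate \<open>0\<close> is needed here.\<close>

definition poisson_measure :: "real \<Rightarrow> nat measure" where
  "poisson_measure r = density (count_space UNIV) (\<lambda>n. ennreal (exp (- r) * r ^ n / fact n))"

text \<open>
  The measure \<open>\<mu> / \<mu>(space \<mu>)\<close> is \<open>uniform_measure \<mu> (space \<mu>)\<close>. If \<open>\<mu> = 0\<close>, this is the null
  measure, but then only the value \<open>N = 0\<close>, i.e. the empty list, has positive probability.
\<close>

definition poisson_law :: "'a measure \<Rightarrow> 'a list measure" where
  "poisson_law \<mu> = poisson_measure (measure \<mu> (space \<mu>)) \<bind>
     (\<lambda>n. iid_points n (uniform_measure \<mu> (space \<mu>)))"

definition poisson_process :: "'w measure \<Rightarrow> 'a measure \<Rightarrow> ('w \<Rightarrow> 'a list) \<Rightarrow> bool" where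
  "poisson_process P \<mu> X \<longleftrightarrow>
     prob_space P \<and> X \<in> P \<rightarrow>\<^sub>M point_lists \<mu> \<and>
     distr P (count_space UNIV) (\<lambda>\<omega>. length (X \<omega>)) = poisson_measure (measure \<mu> (space \<mu>)) \<and>
     (\<forall>n. measure P {\<omega> \<in> space P. length (X \<omega>) = n} > 0 \<longrightarrow>
        distr (uniform_measure P {\<omega> \<in> space P. length (X \<omega>) = n}) (point_lists \<mu>) X =
        iid_points n (uniform_measure \<mu> (space \<mu>)))"

text \<open>
  The likelihood ratio of the Poisson laws with mean measures \<open>\<mu> = density \<nu> r\<close> and \<open>\<nu>\<close>; see
  \<open>poisson_law_density\<close> below.
\<close>

definition poisson_lr :: "'a measure \<Rightarrow> 'a measure \<Rightarrow> ('a \<Rightarrow> real) \<Rightarrow> 'a list \<Rightarrow> real" where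
  "poisson_lr \<mu> \<nu> r xs = exp (measure \<nu> (space \<nu>) - measure \<mu> (space \<mu>)) * prod_list (map r xs)"

text \<open>
  The version of the derivative of \<open>density \<kappa> f\<close> with respect to \<open>density \<kappa> g\<close> given by the
  pointwise quotient, with the convention \<open>0 / 0 = 1\<close>. The value matters when the quotient is
  evaluated at points of a process whose mean measure charges \<open>{g = 0}\<close>.
\<close>

definition density_quotient :: "('a \<Rightarrow> real) \<Rightarrow> ('a \<Rightarrow> real) \<Rightarrow> 'a \<Rightarrow> real" where
  "density_quotient f g x = (if f x = 0 \<and> g x = 0 then 1 else f x / g x)"

definition measure_add :: "'a measure \<Rightarrow> 'a measure \<Rightarrow> 'a measure" where
  "measure_add \<mu> \<nu> = measure_of (space \<mu>) (sets \<mu>) (\<lambda>A. emeasure \<mu> A + emeasure \<nu> A)"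

text \<open>
  The squared Hellinger distance, computed with the dominating measure \<open>\<mu> + \<mu>'\<close>. By
  \<open>hellinger_sq_dominating\<close> below, any other dominating measure gives the same value.
\<close>

definition hellinger_sq :: "'a measure \<Rightarrow> 'a measure \<Rightarrow> real" where
  "hellinger_sq \<mu> \<mu>' = 1 / 2 *
     (\<integral>x. (sqrt (enn2real (RN_deriv (measure_add \<mu> \<mu>') \<mu> x)) -
           sqrt (enn2real (RN_deriv (measure_add \<mu> \<mu>') \<mu>' x)))\<^sup>2 \<partial>measure_add \<mu> \<mu>')"

subsection \<open>Independence of the dominating measure\<close>

lemma sets_measure_add [simp, measurable_cong]: "sets (measure_add \<mu> \<nu>) = sets \<mu>"
  and space_measure_add [simp]: "space (measure_add \<mu> \<nu>) = space \<mu>"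
  by (simp_all add: measure_add_def sets.space_closed sets.sigma_sets_eq space_measure_of_conv)

lemma emeasure_measure_add:
  assumes "sets \<nu> = sets \<mu>" "A \<in> sets \<mu>"
  shows "emeasure (measure_add \<mu> \<nu>) A = emeasure \<mu> A + emeasure \<nu> A"
proof (rule emeasure_measure_of[OF measure_add_def])
  show "countably_additive (sets (measure_add \<mu> \<nu>)) (\<lambda>A. emeasure \<mu> A + emeasure \<nu> A)"
  proof (rule countably_additiveI)
    fix F :: "nat \<Rightarrow> 'a set"
    assume F: "range F \<subseteq> sets (measure_add \<mu> \<nu>)" "disjoint_family F" "\<Union> (range F) \<in> sets (measure_add \<mu> \<nu>)"
    have "(\<Sum>i. emeasure \<mu> (F i) + emeasure \<nu> (F i)) = (\<Sum>i. emeasure \<mu> (F i)) + (\<Sum>i. emeasure \<nu> (F i))"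
      by (rule suminf_add[symmetric]) auto
    also have "(\<Sum>i. emeasure \<mu> (F i)) = emeasure \<mu> (\<Union> (range F))"
      using F by (intro suminf_emeasure) auto
    also have "(\<Sum>i. emeasure \<nu> (F i)) = emeasure \<nu> (\<Union> (range F))"
      using F assms by (intro suminf_emeasure) auto
    finally show "(\<Sum>i. emeasure \<mu> (F i) + emeasure \<nu> (F i)) = emeasure \<mu> (\<Union> (range F)) + emeasure \<nu> (\<Union> (range F))" .
  qed
qed (use assms sets.space_closed in \<open>auto simp: positive_def\<close>)

lemma hellinger_sq_density:
  fixes f g :: "'a \<Rightarrow> real"
  assumes [measurable]: "f \<in> borel_measurable \<nu>" "g \<in> borel_measurable \<nu>"
    and nonneg: "\<And>x. x \<in> space \<nu> \<Longrightarrow> 0 \<le> f x" "\<And>x. x \<in> space \<nu> \<Longrightarrow> 0 \<le> g x"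
    and fin: "finite_measure (density \<nu> f)" "finite_measure (density \<nu> g)"
  shows "hellinger_sq (density \<nu> f) (density \<nu> g) = 1 / 2 * (\<integral>x. (sqrt (f x) - sqrt (g x))\<^sup>2 \<partial>\<nu>)"
proof -
  define s where "s = measure_add (density \<nu> f) (density \<nu> g)"
  have s: "s = density \<nu> (\<lambda>x. ennreal (f x + g x))"
  proof (rule measure_eqI)
    fix A assume "A \<in> sets s"
    then have A[measurable]: "A \<in> sets \<nu>" by (simp add: s_def)
    have "emeasure s A = (\<integral>\<^sup>+x. ennreal (f x) * indicator A x + ennreal (g x) * indicator A x \<partial>\<nu>)"
      by (simp add: s_def emeasure_measure_add emeasure_density nn_integral_add)
    also have "\<dots> = (\<integral>\<^sup>+x. ennreal (f x + g x) * indicator A x \<partial>\<nu>)"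
      by (intro nn_integral_cong) (auto simp: nonneg indicator_def ennreal_plus)
    finally show "emeasure s A = emeasure (density \<nu> (\<lambda>x. ennreal (f x + g x))) A"
      by (simp add: emeasure_density)
  qed (simp add: s_def)
  have sets_s [measurable_cong]: "sets s = sets \<nu>" by (simp add: s_def)
  have "finite_measure s"
  proof (rule finite_measureI)
    have "emeasure s (space s) = emeasure (density \<nu> f) (space \<nu>) + emeasure (density \<nu> g) (space \<nu>)"
      unfolding s_def by (subst emeasure_measure_add) auto
    then show "emeasure s (space s) \<noteq> \<infinity>"
      using finite_measure.finite_emeasure_space[OF fin(1)] finite_measure.finite_emeasure_space[OF fin(2)]
      by simp
  qed
  then interpret s: finite_measure s .
  have part: "AE x in s. ennreal (h x / (f x + g x)) = RN_deriv s (density \<nu> h) x"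
    if [measurable]: "h \<in> borel_measurable \<nu>" and h: "\<And>x. x \<in> space \<nu> \<Longrightarrow> 0 \<le> h x \<and> h x \<le> f x + g x" for h :: "'a \<Rightarrow> real"
  proof (rule s.RN_deriv_unique)
    show "(\<lambda>x. ennreal (h x / (f x + g x))) \<in> borel_measurable s" by measurable
    have "density s (\<lambda>x. ennreal (h x / (f x + g x))) =
        density \<nu> (\<lambda>x. ennreal (f x + g x) * ennreal (h x / (f x + g x)))"
      unfolding s by (subst density_density_eq) auto
    also have "\<dots> = density \<nu> h"
    proof (rule density_cong, measurable, rule AE_I2)
      fix x assume x: "x \<in> space \<nu>"
      then show "ennreal (f x + g x) * ennreal (h x / (f x + g x)) = ennreal (h x)"
        using nonneg[OF x] h[OF x] by (cases "f x + g x = 0") (auto simp: ennreal_mult[symmetric] simp del: ennreal_plus)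
    qed
    finally show "density s (\<lambda>x. ennreal (h x / (f x + g x))) = density \<nu> h" .
  qed
  have nn: "AE x in s. 0 \<le> f x \<and> 0 \<le> g x"
    by (rule AE_I2) (use nonneg sets_eq_imp_space_eq[OF sets_s] in auto)
  have "(\<integral>x. (sqrt (enn2real (RN_deriv s (density \<nu> f) x)) - sqrt (enn2real (RN_deriv s (density \<nu> g) x)))\<^sup>2 \<partial>s)
    = (\<integral>x. (sqrt (f x / (f x + g x)) - sqrt (g x / (f x + g x)))\<^sup>2 \<partial>s)"
  proof (rule integral_cong_AE)
    have "AE x in s. ennreal (f x / (f x + g x)) = RN_deriv s (density \<nu> f) x"
      by (rule part) (use nonneg in auto)
    moreover have "AE x in s. ennreal (g x / (f x + g x)) = RN_deriv s (density \<nu> g) x"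
      by (rule part) (use nonneg in auto)
    ultimately show "AE x in s. (sqrt (enn2real (RN_deriv s (density \<nu> f) x)) - sqrt (enn2real (RN_deriv s (density \<nu> g) x)))\<^sup>2
      = (sqrt (f x / (f x + g x)) - sqrt (g x / (f x + g x)))\<^sup>2"
      using nn
    proof eventually_elim
      case (elim x)
      then show ?case by (simp flip: elim(1,2))
    qed
  qed measurable
  also have "\<dots> = (\<integral>x. (f x + g x) * (sqrt (f x / (f x + g x)) - sqrt (g x / (f x + g x)))\<^sup>2 \<partial>\<nu>)"
    unfolding s by (subst integral_density) (auto intro!: AE_I2 simp: nonneg)
  also have "\<dots> = (\<integral>x. (sqrt (f x) - sqrt (g x))\<^sup>2 \<partial>\<nu>)"
  proof (rule Bochner_Integration.integral_cong[OF refl])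
    fix x assume "x \<in> space \<nu>"
    from nonneg[OF this] show "(f x + g x) * (sqrt (f x / (f x + g x)) - sqrt (g x / (f x + g x)))\<^sup>2 = (sqrt (f x) - sqrt (g x))\<^sup>2"
      by (cases "f x + g x = 0") (auto simp: real_sqrt_divide diff_divide_distrib[symmetric] power_divide)
  qed
  finally show ?thesis unfolding hellinger_sq_def s_def by simp
qed

lemma hellinger_sq_dominating:
  assumes "sigma_finite_measure \<nu>" "finite_measure \<mu>" "finite_measure \<mu>'"
    and "sets \<mu> = sets \<nu>" "sets \<mu>' = sets \<nu>"
    and "absolutely_continuous \<nu> \<mu>" "absolutely_continuous \<nu> \<mu>'"
  shows "hellinger_sq \<mu> \<mu>' =
    1 / 2 * (\<integral>x. (sqrt (enn2real (RN_deriv \<nu> \<mu> x)) - sqrt (enn2real (RN_deriv \<nu> \<mu>' x)))\<^sup>2 \<partial>\<nu>)"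
proof -
  have eq: "density \<nu> (\<lambda>x. ennreal (enn2real (RN_deriv \<nu> \<kappa> x))) = \<kappa>"
    if "finite_measure \<kappa>" "sets \<kappa> = sets \<nu>" "absolutely_continuous \<nu> \<kappa>" for \<kappa>
  proof -
    have "AE x in \<nu>. RN_deriv \<nu> \<kappa> x \<noteq> \<infinity>"
      using that assms(1) finite_measure.axioms(1)[OF that(1)]
      by (intro sigma_finite_measure.RN_deriv_finite) auto
    then have "AE x in \<nu>. ennreal (enn2real (RN_deriv \<nu> \<kappa> x)) = RN_deriv \<nu> \<kappa> x"
      by eventually_elim (simp add: less_top)
    then have "density \<nu> (\<lambda>x. ennreal (enn2real (RN_deriv \<nu> \<kappa> x))) = density \<nu> (RN_deriv \<nu> \<kappa>)"
      by (intro density_cong) auto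
    also have "\<dots> = \<kappa>" using that assms(1) by (simp add: sigma_finite_measure.density_RN_deriv)
    finally show ?thesis .
  qed
  show ?thesis
    using hellinger_sq_density[of "\<lambda>x. enn2real (RN_deriv \<nu> \<mu> x)" \<nu> "\<lambda>x. enn2real (RN_deriv \<nu> \<mu>' x)"]
    using eq[of \<mu>] eq[of \<mu>'] assms by simp
qed

subsection \<open>The law and the likelihood ratio of Poisson processes\<close>

lemma point_lists_sigma_algebra:
  "sigma_algebra (lists (space M))
     {A. A \<subseteq> lists (space M) \<and>
         (\<forall>n. (\<lambda>x. map x [0..<n]) -` A \<inter> space (Pi\<^sub>M {..<n} (\<lambda>_. M)) \<in> sets (Pi\<^sub>M {..<n} (\<lambda>_. M)))}"
proof (rule sigma_algebra_iff2[THEN iffD2], intro conjI ballI allI impI, goal_cases)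
  case 1 then show ?case by auto
next
  case 2 then show ?case by simp
next
  case (3 A)
  have "(\<lambda>x. map x [0..<n]) -` (lists (space M) - A) \<inter> space (Pi\<^sub>M {..<n} (\<lambda>_. M)) =
     space (Pi\<^sub>M {..<n} (\<lambda>_. M)) - ((\<lambda>x. map x [0..<n]) -` A \<inter> space (Pi\<^sub>M {..<n} (\<lambda>_. M)))" for n
    by (auto simp: space_PiM PiE_iff in_lists_conv_set)
  with 3 show ?case by auto
next
  case (4 F)
  have "(\<lambda>x. map x [0..<n]) -` (\<Union> (range F)) \<inter> space (Pi\<^sub>M {..<n} (\<lambda>_. M)) =
     (\<Union>i. (\<lambda>x. map x [0..<n]) -` F i \<inter> space (Pi\<^sub>M {..<n} (\<lambda>_. M)))" for n
    by auto
  moreover have "(\<Union>i. (\<lambda>x. map x [0..<n]) -` F i \<inter> space (Pi\<^sub>M {..<n} (\<lambda>_. M))) \<in> sets (Pi\<^sub>M {..<n} (\<lambda>_. M))" for n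
    using 4 by (intro sets.countable_UN) auto
  moreover have "\<Union> (range F) \<subseteq> lists (space M)" using 4 by blast
  ultimately show ?case by simp
qed

lemma space_point_lists [simp]: "space (point_lists M) = lists (space M)"
  unfolding point_lists_def by (rule space_measure_of) auto

lemma sets_point_lists:
  "sets (point_lists M) = {A. A \<subseteq> lists (space M) \<and>
     (\<forall>n. (\<lambda>x. map x [0..<n]) -` A \<inter> space (Pi\<^sub>M {..<n} (\<lambda>_. M)) \<in> sets (Pi\<^sub>M {..<n} (\<lambda>_. M)))}"
  unfolding point_lists_def
  by (subst sets_measure_of) (auto simp: sigma_algebra.sigma_sets_eq[OF point_lists_sigma_algebra])

lemma point_lists_cong:
  assumes "sets M = sets N"
  shows "point_lists M = point_lists N"
proof -
  have "sets (Pi\<^sub>M I (\<lambda>_. M)) = sets (Pi\<^sub>M I (\<lambda>_. N))" for I :: "nat set"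
    by (rule sets_PiM_cong[OF refl assms])
  moreover have "space (Pi\<^sub>M I (\<lambda>_. M)) = space (Pi\<^sub>M I (\<lambda>_. N))" for I :: "nat set"
    using sets_eq_imp_space_eq[OF assms] by (simp add: space_PiM)
  ultimately show ?thesis
    unfolding point_lists_def sets_eq_imp_space_eq[OF assms] by simp
qed

lemma measurable_list_of [measurable]: "(\<lambda>x. map x [0..<n]) \<in> Pi\<^sub>M {..<n} (\<lambda>_. M) \<rightarrow>\<^sub>M point_lists M"
  by (rule measurableI) (auto simp: sets_point_lists space_PiM PiE_iff)

lemma measurable_point_listsI:
  assumes "\<And>n. (\<lambda>x. f (map x [0..<n])) \<in> Pi\<^sub>M {..<n} (\<lambda>_. M) \<rightarrow>\<^sub>M N"
  shows "f \<in> point_lists M \<rightarrow>\<^sub>M N"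
proof (rule measurableI)
  fix xs assume "xs \<in> space (point_lists M)"
  then have xs: "xs \<in> lists (space M)" by simp
  let ?x = "\<lambda>i\<in>{..<length xs}. xs ! i"
  have "map ?x [0..<length xs] = xs" by (intro nth_equalityI) auto
  moreover have "?x \<in> space (Pi\<^sub>M {..<length xs} (\<lambda>_. M))"
    using xs by (auto simp: space_PiM in_lists_conv_set)
  ultimately show "f xs \<in> space N" using measurable_space[OF assms] by metis
next
  fix A assume A: "A \<in> sets N"
  have "(\<lambda>x. map x [0..<n]) -` (f -` A \<inter> space (point_lists M)) \<inter> space (Pi\<^sub>M {..<n} (\<lambda>_. M)) =
     (\<lambda>x. f (map x [0..<n])) -` A \<inter> space (Pi\<^sub>M {..<n} (\<lambda>_. M))" for n
    by (auto simp: space_PiM PiE_iff)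
  then show "f -` A \<inter> space (point_lists M) \<in> sets (point_lists M)"
    using measurable_sets[OF assms A] by (auto simp: sets_point_lists)
qed

lemma measurable_length_point_lists [measurable]: "length \<in> point_lists M \<rightarrow>\<^sub>M count_space UNIV"
  by (rule measurable_point_listsI) simp

lemma prod_list_map_upt: "prod_list (map h [0..<n]) = (\<Prod>i<n. h i :: 'b :: comm_monoid_mult)"
  by (induction n) (simp_all add: mult.commute)

lemma measurable_prod_list_map [measurable]:
  fixes r :: "'a \<Rightarrow> real"
  assumes [measurable]: "r \<in> borel_measurable M"
  shows "(\<lambda>xs. prod_list (map r xs)) \<in> borel_measurable (point_lists M)"
  by (rule measurable_point_listsI) (simp add: comp_def prod_list_map_upt)

lemma measurable_poisson_lr [measurable]:
  "r \<in> borel_measurable M \<Longrightarrow> poisson_lr \<mu> \<nu> r \<in> borel_measurable (point_lists M)"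
  unfolding poisson_lr_def[abs_def] by measurable

lemma sets_iid_points [simp, measurable_cong]: "sets (iid_points n D) = sets (point_lists D)"
  and space_iid_points [simp]: "space (iid_points n D) = lists (space D)"
  by (simp_all add: iid_points_def)

lemma emeasure_uniform_space_le:
  assumes "finite_measure \<mu>"
  shows "emeasure (uniform_measure \<mu> (space \<mu>)) (space \<mu>) \<le> 1"
proof -
  interpret finite_measure \<mu> by fact
  show ?thesis
  proof (cases "emeasure \<mu> (space \<mu>) = 0")
    case False
    then show ?thesis by (subst emeasure_uniform_measure_1) auto
  qed simp
qed

lemma finite_measure_uniform:
  assumes "finite_measure \<mu>"
  shows "finite_measure (uniform_measure \<mu> (space \<mu>))"
  using order_le_less_trans[OF emeasure_uniform_space_le[OF assms] ennreal_one_less_top]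
  by (intro finite_measureI) (simp del: emeasure_uniform_measure add: less_top)

lemma subprob_space_iid_points:
  assumes "finite_measure \<mu>"
  shows "subprob_space (iid_points n (uniform_measure \<mu> (space \<mu>)))"
proof
  let ?U = "uniform_measure \<mu> (space \<mu>)"
  interpret U: finite_measure ?U by (rule finite_measure_uniform[OF assms])
  interpret product_sigma_finite "\<lambda>_ :: nat. ?U" ..
  have "emeasure (iid_points n ?U) (space (iid_points n ?U)) =
      emeasure (Pi\<^sub>M {..<n} (\<lambda>_. ?U)) (space (Pi\<^sub>M {..<n} (\<lambda>_. ?U)))"
  proof -
    have "(\<lambda>x. map x [0..<n]) -` space (point_lists ?U) \<inter> space (Pi\<^sub>M {..<n} (\<lambda>_. ?U)) = space (Pi\<^sub>M {..<n} (\<lambda>_. ?U))"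
      using measurable_space[OF measurable_list_of[of n ?U]] by blast
    then show ?thesis
      unfolding iid_points_def space_distr
      by (subst emeasure_distr[OF measurable_list_of sets.top]) simp
  qed
  also have "\<dots> = (\<Prod>i<n. emeasure ?U (space ?U))"
    unfolding space_PiM by (rule emeasure_PiM) auto
  also have "\<dots> \<le> 1"
    using emeasure_uniform_space_le[OF assms] by (intro prod_le_1) (auto simp del: emeasure_uniform_measure)
  finally show "emeasure (iid_points n ?U) (space (iid_points n ?U)) \<le> 1" .
  show "space (iid_points n ?U) \<noteq> {}" by auto
qed

lemma iid_points_kernel:
  assumes "finite_measure \<mu>"
  shows "(\<lambda>n. iid_points n (uniform_measure \<mu> (space \<mu>))) \<in>
    poisson_measure (measure \<mu> (space \<mu>)) \<rightarrow>\<^sub>M subprob_algebra (point_lists \<mu>)"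
  using subprob_space_iid_points[OF assms] point_lists_cong[of "uniform_measure \<mu> (space \<mu>)" \<mu>]
  by (auto simp: poisson_measure_def space_subprob_algebra)

lemma sets_poisson_law:
  assumes "finite_measure \<mu>"
  shows "sets (poisson_law \<mu>) = sets (point_lists \<mu>)"
  unfolding poisson_law_def using iid_points_kernel[OF assms]
  by (rule sets_bind_measurable) (simp add: poisson_measure_def)

lemma nn_integral_poisson_law:
  assumes "finite_measure \<mu>" and [measurable]: "f \<in> borel_measurable (point_lists \<mu>)"
  defines "m \<equiv> measure \<mu> (space \<mu>)"
  shows "(\<integral>\<^sup>+xs. f xs \<partial>poisson_law \<mu>) =
    (\<Sum>n. ennreal (exp (- m) * m ^ n / fact n) * (\<integral>\<^sup>+xs. f xs \<partial>iid_points n (uniform_measure \<mu> (space \<mu>))))"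
  unfolding poisson_law_def m_def
  by (subst nn_integral_bind[OF assms(2) iid_points_kernel[OF assms(1)]])
     (simp add: poisson_measure_def nn_integral_density nn_integral_count_space_nat)

lemma PiM_density:
  fixes h :: "'a \<Rightarrow> ennreal"
  assumes "sigma_finite_measure N" "sigma_finite_measure (density N h)" "finite I"
    and [measurable]: "h \<in> borel_measurable N"
  shows "Pi\<^sub>M I (\<lambda>_. density N h) = density (Pi\<^sub>M I (\<lambda>_. N)) (\<lambda>x. \<Prod>i\<in>I. h (x i))"
proof (rule sym)
  interpret N: sigma_finite_measure N by fact
  interpret D: sigma_finite_measure "density N h" by fact
  interpret PN: product_sigma_finite "\<lambda>_. N" ..
  interpret PD: product_sigma_finite "\<lambda>_. density N h" ..
  show "density (Pi\<^sub>M I (\<lambda>_. N)) (\<lambda>x. \<Prod>i\<in>I. h (x i)) = Pi\<^sub>M I (\<lambda>_. density N h)"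
  proof (rule PD.PiM_eqI[OF \<open>finite I\<close>])
    show "sets (density (Pi\<^sub>M I (\<lambda>_. N)) (\<lambda>x. \<Prod>i\<in>I. h (x i))) = sets (Pi\<^sub>M I (\<lambda>_. density N h))"
      by (simp cong: sets_PiM_cong)
    fix A assume "\<And>i. i \<in> I \<Longrightarrow> A i \<in> sets (density N h)"
    then have A: "A i \<in> sets N" if "i \<in> I" for i using that by simp
    have "emeasure (density (Pi\<^sub>M I (\<lambda>_. N)) (\<lambda>x. \<Prod>i\<in>I. h (x i))) (Pi\<^sub>E I A) =
        (\<integral>\<^sup>+x. (\<Prod>i\<in>I. h (x i)) * indicator (Pi\<^sub>E I A) x \<partial>Pi\<^sub>M I (\<lambda>_. N))"
      using A \<open>finite I\<close> by (intro emeasure_density sets_PiM_I_finite) measurable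
    also have "\<dots> = (\<integral>\<^sup>+x. (\<Prod>i\<in>I. h (x i) * indicator (A i) (x i)) \<partial>Pi\<^sub>M I (\<lambda>_. N))"
    proof (rule nn_integral_cong)
      fix x assume "x \<in> space (Pi\<^sub>M I (\<lambda>_. N))"
      then have "indicator (Pi\<^sub>E I A) x = (\<Prod>i\<in>I. indicator (A i) (x i) :: ennreal)"
        using \<open>finite I\<close> by (auto simp: space_PiM PiE_iff indicator_def prod.neutral intro!: prod_zero[symmetric])
      then show "(\<Prod>i\<in>I. h (x i)) * indicator (Pi\<^sub>E I A) x = (\<Prod>i\<in>I. h (x i) * indicator (A i) (x i))"
        by (simp add: prod.distrib)
    qed
    also have "\<dots> = (\<Prod>i\<in>I. \<integral>\<^sup>+x. h x * indicator (A i) x \<partial>N)"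
      using \<open>finite I\<close> A by (intro PN.product_nn_integral_prod) auto
    also have "\<dots> = (\<Prod>i\<in>I. emeasure (density N h) (A i))"
      using A by (intro prod.cong refl emeasure_density[symmetric]) auto
    finally show "emeasure (density (Pi\<^sub>M I (\<lambda>_. N)) (\<lambda>x. \<Prod>i\<in>I. h (x i))) (Pi\<^sub>E I A) =
      (\<Prod>i\<in>I. emeasure (density N h) (A i))" .
  qed
qed

lemma density_uniform_measure:
  assumes "finite_measure \<mu>"
  shows "density (uniform_measure \<mu> (space \<mu>)) (\<lambda>_. ennreal (measure \<mu> (space \<mu>))) = \<mu>"
proof (rule measure_eqI)
  interpret finite_measure \<mu> by fact
  fix A assume "A \<in> sets (density (uniform_measure \<mu> (space \<mu>)) (\<lambda>_. ennreal (measure \<mu> (space \<mu>))))"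
  then have A: "A \<in> sets \<mu>" by simp
  have "emeasure (density (uniform_measure \<mu> (space \<mu>)) (\<lambda>_. ennreal (measure \<mu> (space \<mu>)))) A =
      emeasure \<mu> (space \<mu>) * (emeasure \<mu> A / emeasure \<mu> (space \<mu>))"
    using A sets.sets_into_space[OF A]
    by (simp add: emeasure_density nn_integral_cmult_indicator emeasure_eq_measure[symmetric] Int_absorb1)
  also have "\<dots> = emeasure \<mu> A"
  proof (cases "emeasure \<mu> (space \<mu>) = 0")
    case True
    then show ?thesis using emeasure_space[of \<mu> A] by simp
  next
    case False
    then show ?thesis
      by (simp add: ennreal_times_divide ennreal_mult_divide_eq mult.commute)
  qed
  finally show "emeasure (density (uniform_measure \<mu> (space \<mu>)) (\<lambda>_. ennreal (measure \<mu> (space \<mu>)))) A = emeasure \<mu> A" .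
qed simp

lemma nn_integral_iid_points:
  assumes fin: "finite_measure \<mu>" and [measurable]: "f \<in> borel_measurable (point_lists \<mu>)"
  shows "ennreal (measure \<mu> (space \<mu>)) ^ n * (\<integral>\<^sup>+xs. f xs \<partial>iid_points n (uniform_measure \<mu> (space \<mu>))) =
    (\<integral>\<^sup>+x. f (map x [0..<n]) \<partial>Pi\<^sub>M {..<n} (\<lambda>_. \<mu>))"
proof -
  let ?U = "uniform_measure \<mu> (space \<mu>)" and ?m = "ennreal (measure \<mu> (space \<mu>))"
  have pl [measurable_cong]: "sets (point_lists \<mu>) = sets (point_lists ?U)"
    using point_lists_cong[of ?U \<mu>] by simp
  have f: "f \<in> borel_measurable (point_lists ?U)" by measurable
  have sf: "sigma_finite_measure ?U" "sigma_finite_measure \<mu>"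
    using finite_measure_uniform[OF fin] fin by (auto intro: finite_measure.axioms(1))
  have "Pi\<^sub>M {..<n} (\<lambda>_. \<mu>) = Pi\<^sub>M {..<n} (\<lambda>_. density ?U (\<lambda>_. ?m))"
    by (simp add: density_uniform_measure[OF fin])
  also have "\<dots> = density (Pi\<^sub>M {..<n} (\<lambda>_. ?U)) (\<lambda>x. \<Prod>i<n. ?m)"
    using sf by (intro PiM_density) (auto simp: density_uniform_measure[OF fin])
  finally have *: "Pi\<^sub>M {..<n} (\<lambda>_. \<mu>) = density (Pi\<^sub>M {..<n} (\<lambda>_. ?U)) (\<lambda>x. ?m ^ n)" by simp
  have "(\<integral>\<^sup>+x. f (map x [0..<n]) \<partial>Pi\<^sub>M {..<n} (\<lambda>_. \<mu>)) = ?m ^ n * (\<integral>\<^sup>+x. f (map x [0..<n]) \<partial>Pi\<^sub>M {..<n} (\<lambda>_. ?U))"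
    unfolding * using measurable_compose[OF measurable_list_of f]
    by (subst nn_integral_density) (auto simp: nn_integral_cmult)
  also have "(\<integral>\<^sup>+x. f (map x [0..<n]) \<partial>Pi\<^sub>M {..<n} (\<lambda>_. ?U)) = (\<integral>\<^sup>+xs. f xs \<partial>iid_points n ?U)"
    unfolding iid_points_def using f by (intro nn_integral_distr[symmetric]) auto
  finally show ?thesis by simp
qed

lemma nn_integral_poisson_law':
  assumes "finite_measure \<mu>" and "f \<in> borel_measurable (point_lists \<mu>)"
  shows "(\<integral>\<^sup>+xs. f xs \<partial>poisson_law \<mu>) =
    (\<Sum>n. ennreal (exp (- measure \<mu> (space \<mu>)) / fact n) * (\<integral>\<^sup>+x. f (map x [0..<n]) \<partial>Pi\<^sub>M {..<n} (\<lambda>_. \<mu>)))"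
proof -
  have "ennreal (exp (- m) * m ^ n / fact n) = ennreal (exp (- m) / fact n) * ennreal m ^ n"
    if "0 \<le> m" for m :: real and n
    using that by (simp add: ennreal_mult[symmetric] ennreal_power)
  then show ?thesis
    by (simp add: nn_integral_poisson_law[OF assms] nn_integral_iid_points[OF assms, symmetric] mult.assoc)
qed

lemma poisson_law_density:
  fixes r :: "'a \<Rightarrow> real"
  assumes fin: "finite_measure \<nu>" "finite_measure \<mu>"
    and [measurable]: "r \<in> borel_measurable \<nu>" and nonneg: "\<And>x. x \<in> space \<nu> \<Longrightarrow> 0 \<le> r x"
    and \<mu>: "\<mu> = density \<nu> r"
  shows "poisson_law \<mu> = density (poisson_law \<nu>) (poisson_lr \<mu> \<nu> r)"
proof (rule measure_eqI)
  have pl: "point_lists \<mu> = point_lists \<nu>" by (rule point_lists_cong) (simp add: \<mu>)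
  then show "sets (poisson_law \<mu>) = sets (density (poisson_law \<nu>) (poisson_lr \<mu> \<nu> r))"
    by (simp add: sets_poisson_law fin)
  fix A assume "A \<in> sets (poisson_law \<mu>)"
  then have A[measurable]: "A \<in> sets (point_lists \<nu>)" by (simp add: sets_poisson_law fin pl)
  note sets_poisson_law[OF fin(1), measurable_cong]
  have sf: "sigma_finite_measure \<nu>" "sigma_finite_measure (density \<nu> r)"
    using fin by (auto simp: \<mu> intro: finite_measure.axioms(1))
  let ?m = "measure \<mu> (space \<mu>)" and ?k = "measure \<nu> (space \<nu>)"
  have ind: "(\<lambda>x. indicator A (map x [0..<n]) :: ennreal) \<in> borel_measurable (Pi\<^sub>M {..<n} (\<lambda>_. \<nu>))" for n
    by (rule measurable_compose[OF measurable_list_of]) measurable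
  have "emeasure (density (poisson_law \<nu>) (poisson_lr \<mu> \<nu> r)) A =
      (\<integral>\<^sup>+xs. ennreal (poisson_lr \<mu> \<nu> r xs) * indicator A xs \<partial>poisson_law \<nu>)"
    by (rule emeasure_density) measurable
  also have "\<dots> = (\<Sum>n. ennreal (exp (- ?k) / fact n) *
      (\<integral>\<^sup>+x. ennreal (poisson_lr \<mu> \<nu> r (map x [0..<n])) * indicator A (map x [0..<n]) \<partial>Pi\<^sub>M {..<n} (\<lambda>_. \<nu>)))"
    by (rule nn_integral_poisson_law'[OF fin(1)]) measurable
  also have "\<dots> = (\<Sum>n. ennreal (exp (- ?m) / fact n) *
      (\<integral>\<^sup>+x. indicator A (map x [0..<n]) \<partial>Pi\<^sub>M {..<n} (\<lambda>_. \<mu>)))"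
  proof (rule suminf_cong)
    fix n
    have "(\<integral>\<^sup>+x. indicator A (map x [0..<n]) \<partial>Pi\<^sub>M {..<n} (\<lambda>_. \<mu>)) =
        (\<integral>\<^sup>+x. indicator A (map x [0..<n]) \<partial>density (Pi\<^sub>M {..<n} (\<lambda>_. \<nu>)) (\<lambda>x. \<Prod>i<n. ennreal (r (x i))))"
      unfolding \<mu> using sf by (subst PiM_density) auto
    also have "\<dots> = (\<integral>\<^sup>+x. (\<Prod>i<n. ennreal (r (x i))) * indicator A (map x [0..<n]) \<partial>Pi\<^sub>M {..<n} (\<lambda>_. \<nu>))"
      using ind by (subst nn_integral_density) auto
    finally have 1: "(\<integral>\<^sup>+x. indicator A (map x [0..<n]) \<partial>Pi\<^sub>M {..<n} (\<lambda>_. \<mu>)) = \<dots>" .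
    have "(\<integral>\<^sup>+x. ennreal (poisson_lr \<mu> \<nu> r (map x [0..<n])) * indicator A (map x [0..<n]) \<partial>Pi\<^sub>M {..<n} (\<lambda>_. \<nu>)) =
        (\<integral>\<^sup>+x. ennreal (exp (?k - ?m)) * ((\<Prod>i<n. ennreal (r (x i))) * indicator A (map x [0..<n])) \<partial>Pi\<^sub>M {..<n} (\<lambda>_. \<nu>))"
    proof (rule nn_integral_cong)
      fix x assume "x \<in> space (Pi\<^sub>M {..<n} (\<lambda>_. \<nu>))"
      then have r: "0 \<le> r (x i)" if "i < n" for i using that nonneg by (auto simp: space_PiM PiE_iff)
      then have "0 \<le> (\<Prod>i<n. r (x i))" by (intro prod_nonneg) auto
      with r have "ennreal (poisson_lr \<mu> \<nu> r (map x [0..<n])) = ennreal (exp (?k - ?m)) * (\<Prod>i<n. ennreal (r (x i)))"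
        by (subst prod_ennreal) (simp_all add: poisson_lr_def comp_def prod_list_map_upt ennreal_mult)
      then show "ennreal (poisson_lr \<mu> \<nu> r (map x [0..<n])) * indicator A (map x [0..<n]) =
          ennreal (exp (?k - ?m)) * ((\<Prod>i<n. ennreal (r (x i))) * indicator A (map x [0..<n]))"
        by (simp add: mult.assoc)
    qed
    also have "\<dots> = ennreal (exp (?k - ?m)) * (\<integral>\<^sup>+x. indicator A (map x [0..<n]) \<partial>Pi\<^sub>M {..<n} (\<lambda>_. \<mu>))"
      unfolding 1 using ind by (intro nn_integral_cmult) measurable
    finally show "ennreal (exp (- ?k) / fact n) *
        (\<integral>\<^sup>+x. ennreal (poisson_lr \<mu> \<nu> r (map x [0..<n])) * indicator A (map x [0..<n]) \<partial>Pi\<^sub>M {..<n} (\<lambda>_. \<nu>)) =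
      ennreal (exp (- ?m) / fact n) * (\<integral>\<^sup>+x. indicator A (map x [0..<n]) \<partial>Pi\<^sub>M {..<n} (\<lambda>_. \<mu>))"
      by (simp add: mult.assoc[symmetric] ennreal_mult[symmetric] exp_add[symmetric])
  qed
  also have "\<dots> = (\<integral>\<^sup>+xs. indicator A xs \<partial>poisson_law \<mu>)"
    by (rule nn_integral_poisson_law'[symmetric, OF fin(2)]) (simp add: pl)
  also have "\<dots> = emeasure (poisson_law \<mu>) A"
    by (rule nn_integral_indicator) (simp add: sets_poisson_law fin pl)
  finally show "emeasure (poisson_law \<mu>) A = emeasure (density (poisson_law \<nu>) (poisson_lr \<mu> \<nu> r)) A" by simp
qed

lemma density_density_quotient:
  assumes "f \<in> borel_measurable \<kappa>" "g \<in> borel_measurable \<kappa>"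
    and "\<And>x. x \<in> space \<kappa> \<Longrightarrow> 0 \<le> f x \<and> 0 \<le> g x \<and> (g x = 0 \<longrightarrow> f x = 0)"
  shows "density \<kappa> f = density (density \<kappa> g) (density_quotient f g)"
proof -
  note [measurable] = assms(1,2)
  have "density (density \<kappa> g) (density_quotient f g) =
      density \<kappa> (\<lambda>x. ennreal (g x) * ennreal (density_quotient f g x))"
    unfolding density_quotient_def[abs_def] by (rule density_density_eq) measurable
  also have "\<dots> = density \<kappa> f"
    unfolding density_quotient_def[abs_def]
  proof (rule density_cong, measurable, rule AE_I2)
    fix x assume "x \<in> space \<kappa>"
    from assms(3)[OF this]
    show "ennreal (g x) * ennreal (if f x = 0 \<and> g x = 0 then 1 else f x / g x) = ennreal (f x)"
      by (auto simp: ennreal_mult[symmetric])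
  qed
  finally show ?thesis by simp
qed

lemma poisson_process_law:
  assumes fin: "finite_measure \<mu>" and X: "poisson_process P \<mu> X"
  shows "distr P (point_lists \<mu>) X = poisson_law \<mu>"
proof (rule measure_eqI)
  interpret P: prob_space P using X by (simp add: poisson_process_def)
  have X_meas[measurable]: "X \<in> P \<rightarrow>\<^sub>M point_lists \<mu>" using X by (simp add: poisson_process_def)
  show "sets (distr P (point_lists \<mu>) X) = sets (poisson_law \<mu>)" by (simp add: sets_poisson_law fin)
  fix A assume "A \<in> sets (distr P (point_lists \<mu>) X)"
  then have A[measurable]: "A \<in> sets (point_lists \<mu>)" by simp
  let ?m = "measure \<mu> (space \<mu>)" and ?U = "uniform_measure \<mu> (space \<mu>)"
  define E where "E n = {\<omega> \<in> space P. length (X \<omega>) = n}" for n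
  have E[measurable]: "E n \<in> sets P" for n unfolding E_def by measurable
  define B where "B = X -` A \<inter> space P"
  have B[measurable]: "B \<in> sets P" unfolding B_def by measurable
  have PE: "emeasure P (E n) = ennreal (exp (- ?m) * ?m ^ n / fact n)" for n
  proof -
    have "emeasure P (E n) = emeasure (distr P (count_space UNIV) (\<lambda>\<omega>. length (X \<omega>))) {n}"
      by (subst emeasure_distr) (auto simp: E_def intro!: arg_cong[where f="emeasure P"])
    also have "\<dots> = emeasure (poisson_measure ?m) {n}"
      using X by (simp add: poisson_process_def)
    also have "\<dots> = ennreal (exp (- ?m) * ?m ^ n / fact n)"
      by (simp add: poisson_measure_def emeasure_density)
    finally show ?thesis .
  qed
  have cond: "emeasure P (E n \<inter> B) = emeasure P (E n) * emeasure (iid_points n ?U) A" for n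
  proof (cases "measure P (E n) > 0")
    case True
    then have "distr (uniform_measure P (E n)) (point_lists \<mu>) X = iid_points n ?U"
      using X unfolding poisson_process_def E_def by blast
    then have "emeasure (iid_points n ?U) A = emeasure (distr (uniform_measure P (E n)) (point_lists \<mu>) X) A" by simp
    also have "\<dots> = emeasure (uniform_measure P (E n)) B"
      by (subst emeasure_distr) (auto simp: B_def)
    also have "\<dots> = emeasure P (E n \<inter> B) / emeasure P (E n)" by simp
    finally show ?thesis using True
      by (simp add: ennreal_times_divide P.emeasure_eq_measure divide_ennreal ennreal_mult[symmetric])
  next
    case False
    then have "measure P (E n) = 0" using measure_nonneg[of P "E n"] by linarith
    then have "emeasure P (E n) = 0" by (simp add: P.emeasure_eq_measure)
    moreover have "emeasure P (E n \<inter> B) \<le> emeasure P (E n)" by (intro emeasure_mono) auto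
    ultimately show ?thesis by simp
  qed
  have "emeasure (distr P (point_lists \<mu>) X) A = emeasure P (\<Union>n. E n \<inter> B)"
  proof -
    have "X -` A \<inter> space P = (\<Union>n. E n \<inter> B)" by (auto simp: E_def B_def)
    then show ?thesis by (simp add: emeasure_distr)
  qed
  also have "\<dots> = (\<Sum>n. emeasure P (E n \<inter> B))"
  proof (rule suminf_emeasure[symmetric])
    show "disjoint_family (\<lambda>n. E n \<inter> B)" by (auto simp: disjoint_family_on_def E_def)
  qed auto
  also have "\<dots> = (\<Sum>n. ennreal (exp (- ?m) * ?m ^ n / fact n) * emeasure (iid_points n ?U) A)"
    by (simp only: cond PE)
  also have "\<dots> = (\<integral>\<^sup>+xs. indicator A xs \<partial>poisson_law \<mu>)"
    using A point_lists_cong[of ?U \<mu>]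
    by (subst nn_integral_poisson_law[OF fin]) auto
  also have "\<dots> = emeasure (poisson_law \<mu>) A"
    by (rule nn_integral_indicator) (simp add: sets_poisson_law fin)
  finally show "emeasure (distr P (point_lists \<mu>) X) A = emeasure (poisson_law \<mu>) A" .
qed

end

theory Submission
  imports Defs
begin

text \<open>
  The proof is Chernoff's argument with the square root of the likelihood ratio. Write
  \<open>a = sqrt dpc\<close>, \<open>b = sqrt dnc\<close>, \<open>p = \<xi> b + (1 - \<xi>) a\<close>, \<open>n = \<xi> a + (1 - \<xi>) b\<close>, so that the
  likelihood ratio at a realisation is \<open>exp (\<nu>\<^sub>m(space) - \<pi>\<^sub>m(space))\<close> times the product of
  \<open>(p / n)\<^sup>2\<close> over its points. By Markov's inequality, the probability that its logarithm is at
  least \<open>2 x\<close> is at most \<open>exp (- x)\<close> times the expectation of its square root. For a Poisson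
  process the expectation of a product of \<open>h\<close> over the points is \<open>exp (\<integral> (h - 1) d\<mu>)\<close>
  (\<open>nn_integral_prod_list_poisson_law\<close>), so the exponent to be bounded is

  \<open>- x + \<integral> (n\<^sup>2 - p\<^sup>2) / 2 d\<kappa> + \<integral> (p / n - 1) d\<mu>\<close>.

  Both integrands carry the factor \<open>1 - 2 \<xi>\<close>, and after it is removed the claim holds pointwise
  (\<open>mixed_roots_ratio_bound\<close>): the difference between the two sides, multiplied by \<open>n\<close>, is a
  nonnegative multiple of a square. Integration gives the Hellinger distances.

  The measure \<open>\<mu>\<close> need not be absolutely continuous with respect to \<open>\<kappa>\<close>, so all integrals are
  taken against a measure dominating both, and the pointwise inequality carries an additional
  factor \<open>s\<close>, the root of the density of \<open>\<kappa>\<close>. Where \<open>s = 0\<close> it reduces to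
  \<open>p / n - 1 \<le> (1 - 2 \<xi>) / \<xi>\<close>. This works because the roots are mixed with weight \<open>\<xi> > 0\<close>,
  which keeps \<open>p / n\<close> bounded and positive, with the convention \<open>0 / 0 = 1\<close>. It is what makes
  the bound robust: it holds for every \<open>\<mu>\<close>.

  The second inequality is the first one with the roles of \<open>\<pi>\<close> and \<open>\<nu>\<close> exchanged and \<open>- x\<close> in
  place of \<open>x\<close>, since the exchange inverts the likelihood ratio.
\<close>

section \<open>Densities and Hellinger distances\<close>

lemma finite_density_integrable:
  fixes f :: "'a \<Rightarrow> real"
  assumes [measurable]: "f \<in> borel_measurable M" and nonneg: "\<And>x. x \<in> space M \<Longrightarrow> 0 \<le> f x"
    and fin: "finite_measure (density M f)"
  shows "integrable M f" and "measure (density M f) (space M) = (\<integral>x. f x \<partial>M)"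
proof -
  have e: "emeasure (density M f) (space M) = (\<integral>\<^sup>+x. ennreal (f x) \<partial>M)"
    by (subst emeasure_density) (auto intro!: nn_integral_cong)
  have "emeasure (density M f) (space M) < \<infinity>"
    using finite_measure.finite_emeasure_space[OF fin] by (simp add: less_top)
  then show i: "integrable M f"
    using nonneg by (intro integrableI_nonneg) (auto simp: e)
  have "emeasure (density M f) (space M) = ennreal (\<integral>x. f x \<partial>M)"
    unfolding e using nonneg by (intro nn_integral_eq_integral[OF i]) auto
  moreover have "0 \<le> (\<integral>x. f x \<partial>M)"
    using nonneg by (intro Bochner_Integration.integral_nonneg) auto
  ultimately show "measure (density M f) (space M) = (\<integral>x. f x \<partial>M)"
    by (simp add: measure_def)
qed

lemma integrable_sqrt_diff_squared:
  fixes f g :: "'a \<Rightarrow> real"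
  assumes f: "integrable M f" and g: "integrable M g"
    and nonneg: "\<And>x. x \<in> space M \<Longrightarrow> 0 \<le> f x" "\<And>x. x \<in> space M \<Longrightarrow> 0 \<le> g x"
  shows "integrable M (\<lambda>x. (sqrt (f x) - sqrt (g x))\<^sup>2)"
proof (rule Bochner_Integration.integrable_bound)
  show "integrable M (\<lambda>x. f x + g x)" using f g by simp
  show "(\<lambda>x. (sqrt (f x) - sqrt (g x))\<^sup>2) \<in> borel_measurable M"
    using borel_measurable_integrable[OF f] borel_measurable_integrable[OF g] by measurable
  show "AE x in M. norm ((sqrt (f x) - sqrt (g x))\<^sup>2) \<le> norm (f x + g x)"
  proof (rule AE_I2)
    fix x assume "x \<in> space M"
    with nonneg have "0 \<le> f x" "0 \<le> g x" by auto
    moreover from this have "(sqrt (f x) - sqrt (g x))\<^sup>2 \<le> f x + g x"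
      by (simp add: power2_diff)
    ultimately show "norm ((sqrt (f x) - sqrt (g x))\<^sup>2) \<le> norm (f x + g x)"
      by simp
  qed
qed

lemma hellinger_sq_commute:
  assumes "sets \<mu> = sets \<nu>"
  shows "hellinger_sq \<mu> \<nu> = hellinger_sq \<nu> \<mu>"
proof -
  have "measure_add \<mu> \<nu> = measure_add \<nu> \<mu>"
    using assms sets_eq_imp_space_eq[OF assms] by (simp add: measure_add_def add.commute)
  then show ?thesis
    by (simp add: hellinger_sq_def power2_commute)
qed

text \<open>
  Real-valued densities with respect to \<open>\<kappa> + \<mu>\<close> put the parts of \<open>\<mu>\<close> that are continuous and
  singular with respect to \<open>\<kappa>\<close> on the same footing: the singular part lives on \<open>{k = 0}\<close>.
\<close>

lemma common_dominating_measure: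
  assumes fin: "finite_measure \<kappa>" "finite_measure \<mu>" and sets: "sets \<mu> = sets \<kappa>"
  obtains \<sigma> :: "'a measure" and k m :: "'a \<Rightarrow> real"
  where "sets \<sigma> = sets \<kappa>"
    and "k \<in> borel_measurable \<sigma>" "\<And>x. 0 \<le> k x" "\<kappa> = density \<sigma> k"
    and "m \<in> borel_measurable \<sigma>" "\<And>x. 0 \<le> m x" "\<mu> = density \<sigma> m"
proof -
  define \<sigma> where "\<sigma> = measure_add \<kappa> \<mu>"
  have sets_\<sigma>: "sets \<sigma> = sets \<kappa>" by (simp add: \<sigma>_def)
  have em: "emeasure \<sigma> A = emeasure \<kappa> A + emeasure \<mu> A" if "A \<in> sets \<kappa>" for A
    unfolding \<sigma>_def using sets that by (rule emeasure_measure_add)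
  have "finite_measure \<sigma>"
  proof (rule finite_measureI)
    have "space \<sigma> = space \<kappa>" "space \<mu> = space \<kappa>"
      using sets sets_\<sigma> by (auto dest: sets_eq_imp_space_eq)
    then show "emeasure \<sigma> (space \<sigma>) \<noteq> \<infinity>"
      using finite_measure.finite_emeasure_space[OF fin(1)] finite_measure.finite_emeasure_space[OF fin(2)]
      by (simp add: em)
  qed
  then interpret finite_measure \<sigma> .
  have dens: "\<exists>D :: 'a \<Rightarrow> real. D \<in> borel_measurable \<sigma> \<and> (\<forall>x. 0 \<le> D x) \<and> N = density \<sigma> (\<lambda>x. ennreal (D x))"
    if N: "finite_measure N" "absolutely_continuous \<sigma> N" "sets N = sets \<sigma>" for N
  proof -
    obtain D where D: "D \<in> borel_measurable \<sigma>" "AE x in \<sigma>. RN_deriv \<sigma> N x = ennreal (D x)" "\<And>x. 0 \<le> D x"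
      using real_RN_deriv[OF N] by metis
    have "density \<sigma> D = density \<sigma> (RN_deriv \<sigma> N)"
      using D by (intro density_cong) auto
    also have "\<dots> = N" using N by (intro density_RN_deriv)
    finally show ?thesis using D by auto
  qed
  have "absolutely_continuous \<sigma> \<kappa>" "absolutely_continuous \<sigma> \<mu>"
    using sets_\<sigma> sets em by (auto simp: absolutely_continuous_def null_sets_def)
  then obtain k m :: "'a \<Rightarrow> real"
    where k: "k \<in> borel_measurable \<sigma>" "\<And>x. 0 \<le> k x" "\<kappa> = density \<sigma> k"
      and m: "m \<in> borel_measurable \<sigma>" "\<And>x. 0 \<le> m x" "\<mu> = density \<sigma> m"
    using dens[of \<kappa>] dens[of \<mu>] fin sets sets_\<sigma> by metis
  show ?thesis by (rule that[OF sets_\<sigma> k m])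
qed

section \<open>Exponential moments of a Poisson process\<close>

text \<open>
  Given \<open>n\<close> points, independence turns the expectation of the product into an \<open>n\<close>-th power, and
  the Poisson weights sum these powers to the exponential series of \<open>\<integral> h d\<mu>\<close>.
\<close>

lemma nn_integral_prod_list_poisson_law:
  fixes h :: "'a \<Rightarrow> real"
  assumes fin: "finite_measure \<mu>" and h: "integrable \<mu> h" and nonneg: "\<And>x. x \<in> space \<mu> \<Longrightarrow> 0 \<le> h x"
  shows "(\<integral>\<^sup>+xs. ennreal (prod_list (map h xs)) \<partial>poisson_law \<mu>) = ennreal (exp (\<integral>x. h x - 1 \<partial>\<mu>))"
proof -
  interpret finite_measure \<mu> by fact
  interpret product_sigma_finite "\<lambda>_ :: nat. \<mu>" ..
  note [measurable] = borel_measurable_integrable[OF h]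
  let ?m = "measure \<mu> (space \<mu>)" and ?I = "\<integral>x. h x \<partial>\<mu>"
  have I: "0 \<le> ?I" using nonneg by (intro Bochner_Integration.integral_nonneg) auto
  have power: "(\<integral>\<^sup>+x. ennreal (prod_list (map h (map x [0..<n]))) \<partial>Pi\<^sub>M {..<n} (\<lambda>_. \<mu>)) = ennreal (?I ^ n)" for n
  proof -
    have "(\<integral>\<^sup>+x. ennreal (prod_list (map h (map x [0..<n]))) \<partial>Pi\<^sub>M {..<n} (\<lambda>_. \<mu>)) =
        (\<integral>\<^sup>+x. (\<Prod>i<n. ennreal (h (x i))) \<partial>Pi\<^sub>M {..<n} (\<lambda>_. \<mu>))"
    proof (rule nn_integral_cong)
      fix x assume "x \<in> space (Pi\<^sub>M {..<n} (\<lambda>_. \<mu>))"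
      then have "0 \<le> h (x i)" if "i < n" for i using that nonneg by (auto simp: space_PiM PiE_iff)
      then show "ennreal (prod_list (map h (map x [0..<n]))) = (\<Prod>i<n. ennreal (h (x i)))"
        by (subst prod_ennreal) (simp_all add: comp_def prod_list_map_upt)
    qed
    also have "\<dots> = (\<Prod>i<n. \<integral>\<^sup>+x. ennreal (h x) \<partial>\<mu>)"
      by (rule product_nn_integral_prod) auto
    also have "(\<integral>\<^sup>+x. ennreal (h x) \<partial>\<mu>) = ennreal ?I"
      using nonneg by (intro nn_integral_eq_integral[OF h]) auto
    finally show ?thesis using I by (simp add: ennreal_power)
  qed
  have "(\<integral>\<^sup>+xs. ennreal (prod_list (map h xs)) \<partial>poisson_law \<mu>) =
      (\<Sum>n. ennreal (exp (- ?m) / fact n) * ennreal (?I ^ n))"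
    by (subst nn_integral_poisson_law'[OF fin]) (auto simp only: power, measurable)
  also have "\<dots> = (\<Sum>n. ennreal (exp (- ?m) * (?I ^ n /\<^sub>R fact n)))"
    using I by (intro suminf_cong) (simp add: ennreal_mult[symmetric] field_simps)
  also have "\<dots> = ennreal (exp (- ?m) * exp ?I)"
    using I by (intro suminf_ennreal_eq sums_mult exp_converges) auto
  also have "exp (- ?m) * exp ?I = exp (\<integral>x. h x - 1 \<partial>\<mu>)"
    using h by (simp add: exp_add[symmetric])
  finally show ?thesis .
qed

text \<open>
  Markov's inequality for the square root of \<open>exp c * \<Prod> r(X\<^sub>i)\<close>. The exponent \<open>1 / 2\<close> is the one
  for which the resulting integral relates to Hellinger distances.
\<close>

lemma poisson_process_chernoff:
  fixes r :: "'a \<Rightarrow> real"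
  assumes fin: "finite_measure \<mu>" and X: "poisson_process P \<mu> X"
    and r[measurable]: "r \<in> borel_measurable \<mu>" and pos: "\<And>t. t \<in> space \<mu> \<Longrightarrow> 0 < r t"
    and int: "integrable \<mu> (\<lambda>t. sqrt (r t))"
  shows "measure P {\<omega> \<in> space P. 2 * x \<le> ln (exp c * prod_list (map r (X \<omega>)))}
    \<le> exp (- x + c / 2 + (\<integral>t. sqrt (r t) - 1 \<partial>\<mu>))"
proof -
  interpret P: prob_space P using X by (simp add: poisson_process_def)
  have X_meas[measurable]: "X \<in> P \<rightarrow>\<^sub>M point_lists \<mu>" using X by (simp add: poisson_process_def)
  let ?A = "{\<omega> \<in> space P. 2 * x \<le> ln (exp c * prod_list (map r (X \<omega>)))}"
  let ?h = "\<lambda>xs. prod_list (map (\<lambda>t. sqrt (r t)) xs)"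
  have sqrt_prod: "sqrt (prod_list (map r xs)) = ?h xs" for xs
    by (induction xs) (simp_all add: real_sqrt_mult)
  have prod_pos: "0 < prod_list (map r xs)" if "xs \<in> lists (space \<mu>)" for xs
    using that by induction (simp_all add: pos)
  have A[measurable]: "?A \<in> sets P" by measurable
  have "emeasure P ?A = (\<integral>\<^sup>+\<omega>. indicator ?A \<omega> \<partial>P)" by simp
  also have "\<dots> \<le> (\<integral>\<^sup>+\<omega>. ennreal (exp (- x + c / 2)) * ennreal (?h (X \<omega>)) \<partial>P)"
  proof (rule nn_integral_mono)
    fix \<omega> assume \<omega>: "\<omega> \<in> space P"
    then have "X \<omega> \<in> lists (space \<mu>)" using measurable_space[OF X_meas] by auto
    then have p: "0 < prod_list (map r (X \<omega>))" by (rule prod_pos)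
    have "1 \<le> exp (- x + c / 2) * ?h (X \<omega>)" if "\<omega> \<in> ?A"
    proof -
      let ?L = "ln (prod_list (map r (X \<omega>)))"
      have "2 * x \<le> c + ?L" using that p by (simp add: ln_mult)
      then have "1 \<le> exp (- x + c / 2 + ?L / 2)" by simp
      also have "\<dots> = exp (- x + c / 2) * exp (?L / 2)" by (rule exp_add)
      also have "exp (?L / 2) = ?h (X \<omega>)"
        using p by (simp add: sqrt_prod[symmetric] ln_sqrt[symmetric])
      finally show ?thesis .
    qed
    then show "indicator ?A \<omega> \<le> ennreal (exp (- x + c / 2)) * ennreal (?h (X \<omega>))"
      by (auto simp: indicator_def ennreal_mult'[symmetric] simp del: ennreal_1 simp flip: ennreal_1)
  qed
  also have "\<dots> = ennreal (exp (- x + c / 2)) * (\<integral>\<^sup>+xs. ennreal (?h xs) \<partial>distr P (point_lists \<mu>) X)"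
    by (simp add: nn_integral_cmult nn_integral_distr)
  also have "\<dots> = ennreal (exp (- x + c / 2)) * ennreal (exp (\<integral>t. sqrt (r t) - 1 \<partial>\<mu>))"
    unfolding poisson_process_law[OF fin X]
    using pos by (subst nn_integral_prod_list_poisson_law[OF fin int]) (auto simp: less_imp_le)
  also have "\<dots> = ennreal (exp (- x + c / 2 + (\<integral>t. sqrt (r t) - 1 \<partial>\<mu>)))"
    by (simp add: ennreal_mult[symmetric] exp_add)
  finally show ?thesis by (simp add: P.emeasure_eq_measure)
qed

section \<open>The exponent and the Hellinger distances\<close>

text \<open>
  The pointwise form of the bound on the exponent. Here \<open>w\<close>, \<open>s * a\<close> and \<open>s * b\<close> are the roots of
  the densities of \<open>\<mu>\<close>, \<open>\<pi>\<^sub>c\<close> and \<open>\<nu>\<^sub>c\<close> with respect to a common dominating measure, and \<open>s\<close> is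
  that of \<open>\<kappa>\<close>. With \<open>d = a - b\<close> one has \<open>n = b + \<xi> d\<close>, \<open>p - n = (1 - 2 \<xi>) d\<close> and
  \<open>p + n = a + b\<close>, so \<open>1 - 2 \<xi>\<close> cancels and it remains to show
  \<open>w\<^sup>2 d / n \<le> (w - s b)\<^sup>2 / \<xi> + s\<^sup>2 b d\<close>. As a quadratic polynomial in \<open>w\<close>, the difference of the
  two sides times \<open>n\<close> is \<open>(b / \<xi>) (w - s b - \<xi> s d)\<^sup>2\<close>; equality occurs at \<open>w = s n\<close>, that is,
  when \<open>\<mu> = \<nu>\<^sub>m\<close>.
\<close>

lemma mixed_roots_ratio_bound:
  fixes a b s w \<xi> :: real
  assumes "0 < \<xi>" "\<xi> < 1 / 2" "0 \<le> a" "0 \<le> b"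
  defines "p \<equiv> \<xi> * b + (1 - \<xi>) * a" and "n \<equiv> \<xi> * a + (1 - \<xi>) * b"
  shows "s\<^sup>2 * (n\<^sup>2 - p\<^sup>2) / 2 + w\<^sup>2 * ((if p = 0 \<and> n = 0 then 1 else p / n) - 1)
    \<le> (1 - 2 * \<xi>) * ((w - s * b)\<^sup>2 / \<xi> - (s * a - s * b)\<^sup>2 / 2)"
proof (cases "n = 0")
  case True
  have "\<xi> * a = 0" "(1 - \<xi>) * b = 0"
    using True assms(1-4) by (auto simp: n_def add_nonneg_eq_0_iff)
  then have "a = 0" "b = 0" using assms(1,2) by auto
  then show ?thesis using assms(1,2) by (simp add: p_def n_def)
next
  case False
  then have n: "0 < n" using assms(1-4) by (simp add: n_def order_less_le)
  have "((w - s * b)\<^sup>2 + \<xi> * (s\<^sup>2 * b * (a - b))) * n - \<xi> * (w\<^sup>2 * (a - b)) =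
      b * (w - s * b - \<xi> * s * (a - b))\<^sup>2"
    unfolding n_def by (simp add: algebra_simps power2_eq_square)
  also have "\<dots> \<ge> 0" using assms(4) by simp
  finally have "\<xi> * (w\<^sup>2 * (a - b)) \<le> ((w - s * b)\<^sup>2 + \<xi> * (s\<^sup>2 * b * (a - b))) * n"
    by simp
  also have "\<dots> = \<xi> * (((w - s * b)\<^sup>2 / \<xi> + s\<^sup>2 * b * (a - b)) * n)"
    using assms(1) by (simp add: distrib_left distrib_right)
  finally have "w\<^sup>2 * (a - b) / n \<le> (w - s * b)\<^sup>2 / \<xi> + s\<^sup>2 * b * (a - b)"
    using n assms(1) by (simp only: pos_divide_le_eq mult_le_cancel_left_pos)
  then have le: "w\<^sup>2 * (a - b) / n - s\<^sup>2 * (a\<^sup>2 - b\<^sup>2) / 2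
      \<le> (w - s * b)\<^sup>2 / \<xi> + (s\<^sup>2 * b * (a - b) - s\<^sup>2 * (a\<^sup>2 - b\<^sup>2) / 2)"
    by linarith
  have square: "s\<^sup>2 * b * (a - b) - s\<^sup>2 * (a\<^sup>2 - b\<^sup>2) / 2 = - ((s * a - s * b)\<^sup>2 / 2)"
    by (simp add: field_simps power2_eq_square)
  have "p - n = (1 - 2 * \<xi>) * (a - b)" unfolding p_def n_def by (simp add: algebra_simps)
  moreover have "p / n - 1 = (p - n) / n" using False by (simp add: diff_divide_distrib)
  ultimately have ratio: "p / n - 1 = (1 - 2 * \<xi>) * (a - b) / n" by (simp only:)
  have diff: "n\<^sup>2 - p\<^sup>2 = (1 - 2 * \<xi>) * (b\<^sup>2 - a\<^sup>2)"
    unfolding p_def n_def by (simp add: algebra_simps power2_eq_square)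
  have factor: "s\<^sup>2 * (c * (b\<^sup>2 - a\<^sup>2)) / 2 + w\<^sup>2 * (c * (a - b) / n) =
      c * (w\<^sup>2 * (a - b) / n - s\<^sup>2 * (a\<^sup>2 - b\<^sup>2) / 2)" for c
    using False by (simp add: field_simps)
  have "s\<^sup>2 * (n\<^sup>2 - p\<^sup>2) / 2 + w\<^sup>2 * (p / n - 1) =
      (1 - 2 * \<xi>) * (w\<^sup>2 * (a - b) / n - s\<^sup>2 * (a\<^sup>2 - b\<^sup>2) / 2)"
    unfolding ratio diff by (rule factor)
  also have "\<dots> \<le> (1 - 2 * \<xi>) * ((w - s * b)\<^sup>2 / \<xi> + - ((s * a - s * b)\<^sup>2 / 2))"
    using le assms(2) unfolding square by (intro mult_left_mono) auto
  finally show ?thesis using False by simp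
qed

lemma mixed_roots_density:
  fixes f g fm :: "'a \<Rightarrow> real"
  assumes f[measurable]: "f \<in> borel_measurable \<kappa>" and f0: "\<And>t. t \<in> space \<kappa> \<Longrightarrow> 0 \<le> f t"
    and "finite_measure (density \<kappa> f)"
    and g[measurable]: "g \<in> borel_measurable \<kappa>" and g0: "\<And>t. t \<in> space \<kappa> \<Longrightarrow> 0 \<le> g t"
    and "finite_measure (density \<kappa> g)"
    and \<xi>: "0 < \<xi>" "\<xi> < 1 / 2"
    and fm: "\<And>t. t \<in> space \<kappa> \<Longrightarrow> 0 \<le> fm t \<and> sqrt (fm t) = \<xi> * sqrt (g t) + (1 - \<xi>) * sqrt (f t)"
  shows "fm \<in> borel_measurable \<kappa>" and "integrable \<kappa> fm" and "finite_measure (density \<kappa> fm)"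
proof -
  have eq: "fm t = (\<xi> * sqrt (g t) + (1 - \<xi>) * sqrt (f t))\<^sup>2" if "t \<in> space \<kappa>" for t
    using fm[OF that] by (metis real_sqrt_pow2)
  have "(\<lambda>t. (\<xi> * sqrt (g t) + (1 - \<xi>) * sqrt (f t))\<^sup>2) \<in> borel_measurable \<kappa>" by measurable
  then show meas[measurable]: "fm \<in> borel_measurable \<kappa>"
    using eq by (simp cong: measurable_cong)
  show int: "integrable \<kappa> fm"
  proof (rule Bochner_Integration.integrable_bound)
    show "integrable \<kappa> (\<lambda>t. f t + g t)"
      using assms by (intro Bochner_Integration.integrable_add finite_density_integrable(1)) auto
    show "AE t in \<kappa>. norm (fm t) \<le> norm (f t + g t)"
    proof (rule AE_I2)
      fix t assume t: "t \<in> space \<kappa>"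
      let ?a = "sqrt (f t)" and ?b = "sqrt (g t)"
      \<comment> \<open>Convexity of the square bounds the mixed density by the mixture of the densities.\<close>
      have "\<xi> * ?b\<^sup>2 + (1 - \<xi>) * ?a\<^sup>2 - (\<xi> * ?b + (1 - \<xi>) * ?a)\<^sup>2 = \<xi> * (1 - \<xi>) * (?a - ?b)\<^sup>2"
        by (simp add: algebra_simps power2_eq_square)
      also have "\<dots> \<ge> 0" using \<xi> by simp
      finally have "fm t \<le> \<xi> * g t + (1 - \<xi>) * f t" using eq[OF t] f0[OF t] g0[OF t] by simp
      moreover have "\<xi> * g t \<le> g t" "(1 - \<xi>) * f t \<le> f t"
        using \<xi> f0[OF t] g0[OF t] by (auto intro: mult_left_le_one_le)
      ultimately show "norm (fm t) \<le> norm (f t + g t)"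
        using fm[OF t] f0[OF t] g0[OF t] by simp
    qed
  qed measurable
  show "finite_measure (density \<kappa> fm)"
  proof (rule finite_measureI)
    have "emeasure (density \<kappa> fm) (space \<kappa>) = (\<integral>\<^sup>+t. ennreal (fm t) \<partial>\<kappa>)"
      by (subst emeasure_density) (auto intro!: nn_integral_cong)
    also have "\<dots> = ennreal (\<integral>t. fm t \<partial>\<kappa>)"
      using fm by (intro nn_integral_eq_integral[OF int]) auto
    finally show "emeasure (density \<kappa> fm) (space (density \<kappa> fm)) \<noteq> \<infinity>" by simp
  qed
qed

text \<open>
  As both weights are positive, the mixed densities vanish together, and only where both original
  densities do; hence their quotient is positive and bounded, even where \<open>\<kappa>\<close> has no mass.
\<close>

lemma mixed_roots_quotient:
  fixes f g fm gm \<xi> :: real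
  assumes "0 \<le> f" "0 \<le> g" and "0 < \<xi>" "\<xi> < 1 / 2"
    and "0 \<le> fm" "sqrt fm = \<xi> * sqrt g + (1 - \<xi>) * sqrt f"
    and "0 \<le> gm" "sqrt gm = \<xi> * sqrt f + (1 - \<xi>) * sqrt g"
  shows "fm = 0 \<longleftrightarrow> f = 0 \<and> g = 0" and "gm = 0 \<longleftrightarrow> f = 0 \<and> g = 0"
    and "sqrt fm \<le> (1 / \<xi>) * sqrt gm"
proof -
  have "fm = 0 \<longleftrightarrow> \<xi> * sqrt g + (1 - \<xi>) * sqrt f = 0"
    using assms(6) by (metis real_sqrt_eq_zero_cancel_iff)
  then show "fm = 0 \<longleftrightarrow> f = 0 \<and> g = 0" using assms(1-4) by (auto simp: add_nonneg_eq_0_iff)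
  have "gm = 0 \<longleftrightarrow> \<xi> * sqrt f + (1 - \<xi>) * sqrt g = 0"
    using assms(8) by (metis real_sqrt_eq_zero_cancel_iff)
  then show "gm = 0 \<longleftrightarrow> f = 0 \<and> g = 0" using assms(1-4) by (simp add: add_nonneg_eq_0_iff)
  have "\<xi> * (\<xi> * sqrt g) \<le> 1 * ((1 - \<xi>) * sqrt g)" "\<xi> * ((1 - \<xi>) * sqrt f) \<le> \<xi> * (1 * sqrt f)"
    using assms(1-4) by (intro mult_mono; simp)+
  then have "\<xi> * sqrt fm \<le> sqrt gm" unfolding assms(6,8) by (simp add: algebra_simps)
  then show "sqrt fm \<le> (1 / \<xi>) * sqrt gm" using assms(3) by (simp add: field_simps)
qed

text \<open>
  The integral of \<open>mixed_roots_ratio_bound\<close> over a measure that dominates \<open>\<kappa>\<close> and \<open>\<mu>\<close>.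
\<close>

lemma mixed_roots_exponent_bound:
  fixes f g fm gm :: "'a \<Rightarrow> real"
  defines "q \<equiv> density_quotient fm gm"
  assumes fin: "finite_measure \<kappa>"
    and f[measurable]: "f \<in> borel_measurable \<kappa>" and f0: "\<And>t. t \<in> space \<kappa> \<Longrightarrow> 0 \<le> f t"
    and finf: "finite_measure (density \<kappa> f)"
    and g[measurable]: "g \<in> borel_measurable \<kappa>" and g0: "\<And>t. t \<in> space \<kappa> \<Longrightarrow> 0 \<le> g t"
    and fing: "finite_measure (density \<kappa> g)"
    and \<xi>: "0 < \<xi>" "\<xi> < 1 / 2"
    and fm: "\<And>t. t \<in> space \<kappa> \<Longrightarrow> 0 \<le> fm t \<and> sqrt (fm t) = \<xi> * sqrt (g t) + (1 - \<xi>) * sqrt (f t)"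
    and gm: "\<And>t. t \<in> space \<kappa> \<Longrightarrow> 0 \<le> gm t \<and> sqrt (gm t) = \<xi> * sqrt (f t) + (1 - \<xi>) * sqrt (g t)"
    and \<mu>: "sets \<mu> = sets \<kappa>" "finite_measure \<mu>"
  shows "integrable \<mu> (\<lambda>t. sqrt (q t))"
    and "(measure (density \<kappa> gm) (space \<kappa>) - measure (density \<kappa> fm) (space \<kappa>)) / 2 +
      (\<integral>t. sqrt (q t) - 1 \<partial>\<mu>)
    \<le> (1 - 2 * \<xi>) * (2 / \<xi> * hellinger_sq \<mu> (density \<kappa> g) - hellinger_sq (density \<kappa> f) (density \<kappa> g))"
proof -
  note fm_props = mixed_roots_density[OF f f0 finf g g0 fing \<xi> fm]
  note gm_props = mixed_roots_density[OF g g0 fing f f0 finf \<xi> gm]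
  note [measurable] = fm_props(1) gm_props(1)
  have space_\<mu>: "space \<mu> = space \<kappa>" using \<mu>(1) by (rule sets_eq_imp_space_eq)
  interpret \<mu>: finite_measure \<mu> by fact
  have q_meas: "q \<in> borel_measurable \<kappa>" unfolding q_def density_quotient_def[abs_def] by measurable
  then have q_meas_\<mu>[measurable]: "q \<in> borel_measurable \<mu>"
    using measurable_cong_sets[OF \<mu>(1) refl] by blast
  have sqrt_q: "sqrt (q t) = (if sqrt (fm t) = 0 \<and> sqrt (gm t) = 0 then 1 else sqrt (fm t) / sqrt (gm t))"
    if "t \<in> space \<kappa>" for t
    unfolding q_def
    by (simp add: density_quotient_def real_sqrt_divide)
  show int_q: "integrable \<mu> (\<lambda>t. sqrt (q t))"
  proof (rule \<mu>.integrable_const_bound[where B="1 / \<xi>"])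
    show "AE t in \<mu>. norm (sqrt (q t)) \<le> 1 / \<xi>"
    proof (rule AE_I2)
      fix t assume "t \<in> space \<mu>"
      then have t: "t \<in> space \<kappa>" using space_\<mu> by simp
      note r = mixed_roots_quotient[OF f0[OF t] g0[OF t] \<xi> fm[OF t, THEN conjunct1] fm[OF t, THEN conjunct2]
        gm[OF t, THEN conjunct1] gm[OF t, THEN conjunct2]]
      show "norm (sqrt (q t)) \<le> 1 / \<xi>"
      proof (cases "gm t = 0")
        case True
        then show ?thesis using r \<xi> by (simp add: sqrt_q[OF t])
      next
        case False
        have nn: "0 \<le> fm t" "0 \<le> gm t" using fm[OF t] gm[OF t] by auto
        with False have "0 < sqrt (gm t)" by simp
        with r(3) have "sqrt (fm t) / sqrt (gm t) \<le> 1 / \<xi>" by (simp only: pos_divide_le_eq)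
        with nn False show ?thesis by (simp add: sqrt_q[OF t])
      qed
    qed
  qed measurable
  obtain \<sigma> k m where sets_\<sigma>: "sets \<sigma> = sets \<kappa>"
    and k[measurable]: "k \<in> borel_measurable \<sigma>" and k0: "\<And>x. 0 \<le> k x" and \<kappa>_eq: "\<kappa> = density \<sigma> (\<lambda>x. ennreal (k x))"
    and m[measurable]: "m \<in> borel_measurable \<sigma>" and m0: "\<And>x. 0 \<le> m x" and \<mu>_eq: "\<mu> = density \<sigma> (\<lambda>x. ennreal (m x))"
    using common_dominating_measure[OF fin \<mu>(2,1)] by metis
  have space_\<sigma>: "space \<sigma> = space \<kappa>" using sets_\<sigma> by (rule sets_eq_imp_space_eq)
  have to_\<sigma>: "h \<in> borel_measurable \<kappa> \<Longrightarrow> h \<in> borel_measurable \<sigma>" for h :: "'a \<Rightarrow> real"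
    using measurable_cong_sets[OF sets_\<sigma> refl] by blast
  note [measurable] = to_\<sigma>[OF f] to_\<sigma>[OF g] to_\<sigma>[OF fm_props(1)] to_\<sigma>[OF gm_props(1)] to_\<sigma>[OF q_meas]
  have dens: "density \<kappa> h = density \<sigma> (\<lambda>t. k t * h t)"
    if [measurable]: "h \<in> borel_measurable \<sigma>" for h :: "'a \<Rightarrow> real"
  proof -
    have "density \<kappa> h = density \<sigma> (\<lambda>x. ennreal (k x) * ennreal (h x))"
      unfolding \<kappa>_eq by (rule density_density_eq) measurable
    then show ?thesis by (simp add: ennreal_mult'[OF k0])
  qed
  have props: "integrable \<sigma> (\<lambda>t. k t * h t) \<and> measure (density \<kappa> h) (space \<kappa>) = (\<integral>t. k t * h t \<partial>\<sigma>)"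
    if [measurable]: "h \<in> borel_measurable \<sigma>" and "\<And>t. t \<in> space \<kappa> \<Longrightarrow> 0 \<le> h t" "finite_measure (density \<kappa> h)"
    for h :: "'a \<Rightarrow> real"
    using finite_density_integrable[of "\<lambda>t. k t * h t" \<sigma>] that k0 space_\<sigma> by (simp add: dens)
  have F: "integrable \<sigma> (\<lambda>t. k t * f t)" and G: "integrable \<sigma> (\<lambda>t. k t * g t)"
    and FM: "integrable \<sigma> (\<lambda>t. k t * fm t)" "measure (density \<kappa> fm) (space \<kappa>) = (\<integral>t. k t * fm t \<partial>\<sigma>)"
    and GM: "integrable \<sigma> (\<lambda>t. k t * gm t)" "measure (density \<kappa> gm) (space \<kappa>) = (\<integral>t. k t * gm t \<partial>\<sigma>)"
    using props[of f] props[of g] props[of fm] props[of gm] f0 g0 fm gm finf fing fm_props(3) gm_props(3) by auto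
  have M: "integrable \<sigma> m"
    using finite_density_integrable(1)[of m \<sigma>] m0 \<mu>(2) by (simp add: \<mu>_eq)
  have "integrable \<mu> (\<lambda>t. sqrt (q t) - 1)" using int_q by simp
  then have Q: "integrable \<sigma> (\<lambda>t. m t * (sqrt (q t) - 1))"
    unfolding \<mu>_eq using m0 by (subst (asm) integrable_density) auto
  have Q_eq: "(\<integral>t. sqrt (q t) - 1 \<partial>\<mu>) = (\<integral>t. m t * (sqrt (q t) - 1) \<partial>\<sigma>)"
    unfolding \<mu>_eq using m0 by (subst integral_density) auto
  have H1: "integrable \<sigma> (\<lambda>t. (sqrt (m t) - sqrt (k t * g t))\<^sup>2)"
    using M G m0 k0 g0 space_\<sigma> by (intro integrable_sqrt_diff_squared) auto
  have H2: "integrable \<sigma> (\<lambda>t. (sqrt (k t * f t) - sqrt (k t * g t))\<^sup>2)"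
    using F G k0 f0 g0 space_\<sigma> by (intro integrable_sqrt_diff_squared) auto
  have H1_eq: "hellinger_sq \<mu> (density \<kappa> g) = 1 / 2 * (\<integral>t. (sqrt (m t) - sqrt (k t * g t))\<^sup>2 \<partial>\<sigma>)"
    using hellinger_sq_density[of m \<sigma> "\<lambda>t. k t * g t"] m0 k0 g0 space_\<sigma> \<mu>(2) fing
    by (simp add: dens \<mu>_eq)
  have H2_eq: "hellinger_sq (density \<kappa> f) (density \<kappa> g) = 1 / 2 * (\<integral>t. (sqrt (k t * f t) - sqrt (k t * g t))\<^sup>2 \<partial>\<sigma>)"
    using hellinger_sq_density[of "\<lambda>t. k t * f t" \<sigma> "\<lambda>t. k t * g t"] k0 f0 g0 space_\<sigma> finf fing
    by (simp add: dens)
  have "(\<integral>t. (k t * gm t - k t * fm t) / 2 + m t * (sqrt (q t) - 1) \<partial>\<sigma>)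
    \<le> (\<integral>t. (1 - 2 * \<xi>) * ((sqrt (m t) - sqrt (k t * g t))\<^sup>2 / \<xi> - (sqrt (k t * f t) - sqrt (k t * g t))\<^sup>2 / 2) \<partial>\<sigma>)"
  proof (rule integral_mono)
    fix t assume "t \<in> space \<sigma>"
    then have t: "t \<in> space \<kappa>" by (simp add: space_\<sigma>)
    have eq: "fm t = (\<xi> * sqrt (g t) + (1 - \<xi>) * sqrt (f t))\<^sup>2" "gm t = (\<xi> * sqrt (f t) + (1 - \<xi>) * sqrt (g t))\<^sup>2"
      using fm[OF t] gm[OF t] by (metis real_sqrt_pow2)+
    have "(sqrt (k t))\<^sup>2 * (gm t - fm t) / 2 + (sqrt (m t))\<^sup>2 * (sqrt (q t) - 1)
      \<le> (1 - 2 * \<xi>) * ((sqrt (m t) - sqrt (k t) * sqrt (g t))\<^sup>2 / \<xi> - (sqrt (k t) * sqrt (f t) - sqrt (k t) * sqrt (g t))\<^sup>2 / 2)"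
      unfolding sqrt_q[OF t] fm[OF t, THEN conjunct2] gm[OF t, THEN conjunct2] unfolding eq
      using \<xi> f0[OF t] g0[OF t] by (intro mixed_roots_ratio_bound) auto
    then show "(k t * gm t - k t * fm t) / 2 + m t * (sqrt (q t) - 1)
      \<le> (1 - 2 * \<xi>) * ((sqrt (m t) - sqrt (k t * g t))\<^sup>2 / \<xi> - (sqrt (k t * f t) - sqrt (k t * g t))\<^sup>2 / 2)"
      using k0 m0 by (simp add: real_sqrt_mult right_diff_distrib)
  qed (use FM GM Q H1 H2 in auto)
  then show "(measure (density \<kappa> gm) (space \<kappa>) - measure (density \<kappa> fm) (space \<kappa>)) / 2 + (\<integral>t. sqrt (q t) - 1 \<partial>\<mu>)
    \<le> (1 - 2 * \<xi>) * (2 / \<xi> * hellinger_sq \<mu> (density \<kappa> g) - hellinger_sq (density \<kappa> f) (density \<kappa> g))"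
    using FM GM Q H1 H2 by (simp add: Q_eq H1_eq H2_eq)
qed

section \<open>Error bounds for the test\<close>

lemma poisson_lr_mixed_roots_tail:
  fixes f g fm gm :: "'a \<Rightarrow> real"
  assumes fin: "finite_measure \<kappa>"
    and f: "f \<in> borel_measurable \<kappa>" and f0: "\<And>t. t \<in> space \<kappa> \<Longrightarrow> 0 \<le> f t"
    and finf: "finite_measure (density \<kappa> f)"
    and g: "g \<in> borel_measurable \<kappa>" and g0: "\<And>t. t \<in> space \<kappa> \<Longrightarrow> 0 \<le> g t"
    and fing: "finite_measure (density \<kappa> g)"
    and \<xi>: "0 < \<xi>" "\<xi> < 1 / 2"
    and fm: "\<And>t. t \<in> space \<kappa> \<Longrightarrow> 0 \<le> fm t \<and> sqrt (fm t) = \<xi> * sqrt (g t) + (1 - \<xi>) * sqrt (f t)"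
    and gm: "\<And>t. t \<in> space \<kappa> \<Longrightarrow> 0 \<le> gm t \<and> sqrt (gm t) = \<xi> * sqrt (f t) + (1 - \<xi>) * sqrt (g t)"
    and \<mu>: "sets \<mu> = sets \<kappa>" "finite_measure \<mu>"
    and X: "poisson_process P \<mu> X"
  shows "measure P {\<omega> \<in> space P.
      2 * x \<le> ln (poisson_lr (density \<kappa> fm) (density \<kappa> gm) (density_quotient fm gm) (X \<omega>))}
    \<le> exp (- x + (1 - 2 * \<xi>) * (2 / \<xi> * hellinger_sq \<mu> (density \<kappa> g) - hellinger_sq (density \<kappa> f) (density \<kappa> g)))"
proof -
  note [measurable] = mixed_roots_density(1)[OF f f0 finf g g0 fing \<xi> fm] mixed_roots_density(1)[OF g g0 fing f f0 finf \<xi> gm]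
  note bound = mixed_roots_exponent_bound[OF fin f f0 finf g g0 fing \<xi> fm gm \<mu>]
  let ?q = "density_quotient fm gm"
  let ?c = "measure (density \<kappa> gm) (space \<kappa>) - measure (density \<kappa> fm) (space \<kappa>)"
  have "?q \<in> borel_measurable \<kappa>" unfolding density_quotient_def[abs_def] by measurable
  then have q: "?q \<in> borel_measurable \<mu>" using measurable_cong_sets[OF \<mu>(1) refl] by blast
  have pos: "0 < ?q t" if "t \<in> space \<mu>" for t
  proof -
    have t: "t \<in> space \<kappa>" using that sets_eq_imp_space_eq[OF \<mu>(1)] by simp
    show ?thesis
      using mixed_roots_quotient(1,2)[OF f0[OF t] g0[OF t] \<xi> fm[OF t, THEN conjunct1] fm[OF t, THEN conjunct2]
        gm[OF t, THEN conjunct1] gm[OF t, THEN conjunct2]] fm[OF t] gm[OF t]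
      by (auto simp: density_quotient_def order_less_le)
  qed
  have "measure P {\<omega> \<in> space P. 2 * x \<le> ln (poisson_lr (density \<kappa> fm) (density \<kappa> gm) ?q (X \<omega>))}
    \<le> exp (- x + ?c / 2 + (\<integral>t. sqrt (?q t) - 1 \<partial>\<mu>))"
    using poisson_process_chernoff[OF \<mu>(2) X q pos bound(1), of x ?c] by (simp add: poisson_lr_def)
  also have "\<dots> \<le> exp (- x + (1 - 2 * \<xi>) * (2 / \<xi> * hellinger_sq \<mu> (density \<kappa> g) - hellinger_sq (density \<kappa> f) (density \<kappa> g)))"
    using bound(2) by simp
  finally show ?thesis .
qed

text \<open>
  An exact inverse for every list, by the symmetry of the convention \<open>0 / 0 = 1\<close> and of the
  default \<open>c / 0 = 0\<close>.
\<close>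

lemma poisson_lr_swap:
  "poisson_lr \<nu> \<mu> (density_quotient g f) xs = inverse (poisson_lr \<mu> \<nu> (density_quotient f g) xs)"
proof -
  have "prod_list (map (density_quotient g f) xs) = inverse (prod_list (map (density_quotient f g) xs))"
    by (induction xs) (simp_all add: density_quotient_def)
  then show ?thesis by (simp add: poisson_lr_def exp_minus[symmetric])
qed

theorem theorem5:
  fixes \<kappa> \<pi>\<^sub>c \<nu>\<^sub>c \<pi>\<^sub>m \<nu>\<^sub>m \<mu> :: "'a measure"
    and dpc dnc dpm dnm :: "'a \<Rightarrow> real"
    and \<xi> x :: real
    and P :: "'w measure" and X :: "'w \<Rightarrow> 'a list"
  assumes "finite_measure \<kappa>"
    and "dpc \<in> borel_measurable \<kappa>" "\<And>t. t \<in> space \<kappa> \<Longrightarrow> 0 \<le> dpc t"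
    and "\<pi>\<^sub>c = density \<kappa> dpc" "finite_measure \<pi>\<^sub>c"
    and "dnc \<in> borel_measurable \<kappa>" "\<And>t. t \<in> space \<kappa> \<Longrightarrow> 0 \<le> dnc t"
    and "\<nu>\<^sub>c = density \<kappa> dnc" "finite_measure \<nu>\<^sub>c"
    and "0 < \<xi>" "\<xi> < 1 / 2"
    and "\<And>t. t \<in> space \<kappa> \<Longrightarrow> 0 \<le> dpm t \<and> sqrt (dpm t) = \<xi> * sqrt (dnc t) + (1 - \<xi>) * sqrt (dpc t)"
    and "\<And>t. t \<in> space \<kappa> \<Longrightarrow> 0 \<le> dnm t \<and> sqrt (dnm t) = \<xi> * sqrt (dpc t) + (1 - \<xi>) * sqrt (dnc t)"
    and "\<pi>\<^sub>m = density \<kappa> dpm" "\<nu>\<^sub>m = density \<kappa> dnm"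
    and "sets \<mu> = sets \<kappa>" "finite_measure \<mu>"
    and "poisson_process P \<mu> X"
  shows "measure P {\<omega> \<in> space P. ln (poisson_lr \<pi>\<^sub>m \<nu>\<^sub>m (density_quotient dpm dnm) (X \<omega>)) \<ge> 2 * x}
      \<le> exp (- x + (1 - 2 * \<xi>) * (2 / \<xi> * hellinger_sq \<mu> \<nu>\<^sub>c - hellinger_sq \<pi>\<^sub>c \<nu>\<^sub>c)) \<and>
    measure P {\<omega> \<in> space P. ln (poisson_lr \<pi>\<^sub>m \<nu>\<^sub>m (density_quotient dpm dnm) (X \<omega>)) \<le> 2 * x}
      \<le> exp (x + (1 - 2 * \<xi>) * (2 / \<xi> * hellinger_sq \<mu> \<pi>\<^sub>c - hellinger_sq \<pi>\<^sub>c \<nu>\<^sub>c))"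
proof
  note tail = poisson_lr_mixed_roots_tail[OF assms(1) assms(2,3) _ assms(6,7) _ assms(10-13,16-18)]
  note tail_swapped = poisson_lr_mixed_roots_tail[OF assms(1) assms(6,7) _ assms(2,3) _ assms(10,11,13,12,16-18)]
  show "measure P {\<omega> \<in> space P. ln (poisson_lr \<pi>\<^sub>m \<nu>\<^sub>m (density_quotient dpm dnm) (X \<omega>)) \<ge> 2 * x}
      \<le> exp (- x + (1 - 2 * \<xi>) * (2 / \<xi> * hellinger_sq \<mu> \<nu>\<^sub>c - hellinger_sq \<pi>\<^sub>c \<nu>\<^sub>c))"
    using tail[of x] assms(5,9) unfolding assms(4,8,14,15) by simp
  have "ln (poisson_lr \<nu>\<^sub>m \<pi>\<^sub>m (density_quotient dnm dpm) xs) = - ln (poisson_lr \<pi>\<^sub>m \<nu>\<^sub>m (density_quotient dpm dnm) xs)" for xs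
    unfolding poisson_lr_swap[of \<nu>\<^sub>m] by (rule ln_inverse)
  then show "measure P {\<omega> \<in> space P. ln (poisson_lr \<pi>\<^sub>m \<nu>\<^sub>m (density_quotient dpm dnm) (X \<omega>)) \<le> 2 * x}
      \<le> exp (x + (1 - 2 * \<xi>) * (2 / \<xi> * hellinger_sq \<mu> \<pi>\<^sub>c - hellinger_sq \<pi>\<^sub>c \<nu>\<^sub>c))"
    using tail_swapped[of "- x"] assms(5,9) hellinger_sq_commute[of \<pi>\<^sub>c \<nu>\<^sub>c]
    unfolding assms(4,8,14,15) by simp
qed

end
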